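(* Assume that the events $E_1,E_2,E_3,H_1,H_2,H_3$ are logically independent, with $H_1\neq\emptyset$, $H_2\neq\emptyset$, $H_3\neq\emptyset$. If the assessment $\mathcal M=(x_1,x_2,x_3,x_{12},x_{13},x_{23},x_{123})$ on $\mathcal F=\{\mathcal C_1,\mathcal C_2,\mathcal C_3,\mathcal C_{12},\mathcal C_{13},\mathcal C_{23},\mathcal C_{123}\}$ is such that $(x_1,x_2,x_3)\in[0,1]^3$, $x_{ij}=x_ix_j$ for $i\neq j$, and $x_{123}=x_1x_2x_3$, then $\mathcal M$ is coherent. Moreover, $\mathcal C_{ij}=\mathcal C_i\mathcal C_j$ for $i\neq j$, and $\mathcal C_{123}=\mathcal C_1\mathcal C_2\mathcal C_3$ (as random quantities).
   Context: **Events.** Events are subsets of a set $\Omega$ of elementary outcomes; $\overline{E}$ is the complement of $E$, juxtaposition $EF$ denotes intersection, $\vee$ denotes union. Events $F_1,\dots,F_n$ are logically independent if all $2^n$ intersections $F_1^*\cdots F_n^*$, with $F_i^*\in\{F_i,\overline{F}_i\}$, are nonempty. **Conjunctions.** Given conditional events $E_1|H_1,E_2|H_2,E_3|H_3$ and a real number $x_S$ for each nonempty $S\subseteq\{1,2,3\}$ (written $x_i,x_{ij},x_{123}$, with $x_{ij}=x_{ji}$), where $x_S$ is the prevision assessed on $\bigwedge_{i\in S}(E_i|H_i)$, the conjunction $\mathcal C_S=\bigwedge_{i\in S}(E_i|H_i)$ (written $\mathcal C_i,\mathcal C_{ij},\mathcal C_{123}$) is the random quantity equal to: $1$ on $\bigwedge_{i\in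 S}E_iH_i$; $0$ on $\bigvee_{i\in S}\overline{E}_iH_i$; and $x_{S'}$ on $\bigwedge_{i\in S'}\overline{H}_i\wedge\bigwedge_{i\in S\setminus S'}E_iH_i$, for each $\emptyset\neq S'\subseteq S$. In particular $\mathcal C_i=E_i|H_i$ equals $1$ on $E_iH_i$, $0$ on $\overline{E}_iH_i$, $x_i$ on $\overline{H}_i$. $\mathcal C_S$ is a conditional random quantity with conditioning event $\bigvee_{i\in S}H_i$ and prevision $x_S$. **Coherence.** Let $\mathcal F=\{X_1|K_1,\dots,X_n|K_n\}$ be a finite family of conditional random quantities, where $X_i$ takes finitely many real values when the conditioning event $K_i\ne\emptyset$ is true, and let $\mathcal M=(\mu_1,\dots,\mu_n)\in\mathbb R^n$ be a (prevision) assessment, $\mu_i=\mathbb P(X_i|K_i)$. Let $C_1,\dots,C_m$ be the constituents contained in $K_1\vee\cdots\vee K_n$, i.e. the nonempty atoms of the finite partition generated by the events $K_i$ and the events $(X_i=\text{value})\cap K_i$. To $C_h$ associate $Q_h=(q_{h1},\dots,q_{hn})$, where $q_{hi}$ is the value of $X_i$ on $C_h$ if $C_h\subseteq K_i$, and $q_{hi}=\mu_i$ if $C_h\subseteq\overline{K}_i$. Let $S$ be the set of vectors $(\lambda_1,\dots,\lambda_m)$ with $\lambda_h\ge 0$, $\sum_h\lambda_h=1$, $\sum_h\lambda_hQ_h=\mathcal M$, and, when $S\neq\emptyset$, let $I_0=\{i:\max_{\Lambda\in S}\sum_{h:C_h\subseteq K_i}\lambda_h=0\}$. Then $\mathcal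 M$ is coherent on $\mathcal F$ if and only if (i) $S\neq\emptyset$, and (ii) if $I_0\ne\emptyset$, then the sub-assessment $(\mu_i,\ i\in I_0)$ on $\{X_i|K_i,\ i\in I_0\}$ is coherent (the recursion terminates because $I_0$ is a proper subset of $\{1,\dots,n\}$). *)

theory Defs imports Complex_Main begin

text \<open>The set of elementary outcomes is \<open>UNIV :: 'w set\<close>; events are sets of type \<open>'w set\<close>.\<close>

definition logically_independent :: "'w set list \<Rightarrow> bool" where
  "logically_independent Fs \<longleftrightarrow>
     (\<forall>bs. length bs = length Fs \<longrightarrow>
        (\<Inter>i\<in>{..<length Fs}. if bs ! i then Fs ! i else - (Fs ! i)) \<noteq> {})"

text \<open>Throughout, a family of conditional random quantities \<open>X i | K i\<close> (\<open>i \<in> I\<close>) is given by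
  functions \<open>X\<close>, \<open>K\<close> and an index set \<open>I\<close>; an assessment is a function \<open>\<mu>\<close> on the indices.
  Only the values of \<open>X i\<close> on \<open>K i\<close> are ever used for coherence.\<close>

definition cond_random_family ::
  "('i \<Rightarrow> 'w \<Rightarrow> real) \<Rightarrow> ('i \<Rightarrow> 'w set) \<Rightarrow> 'i set \<Rightarrow> bool" where
  "cond_random_family X K I \<longleftrightarrow> finite I \<and> (\<forall>i\<in>I. K i \<noteq> {} \<and> finite (X i ` K i))"

definition generating_events ::
  "('i \<Rightarrow> 'w \<Rightarrow> real) \<Rightarrow> ('i \<Rightarrow> 'w set) \<Rightarrow> 'i set \<Rightarrow> 'w set set" where
  "generating_events X K I =
     {K i | i. i \<in> I} \<union> {{w \<in> K i. X i w = v} | i v. i \<in> I \<and> v \<in> X i ` K i}"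

text \<open>The nonempty atoms of the partition generated by a set of events: each atom is the set of
  all outcomes that lie in exactly the same events of \<open>G\<close> as some given outcome \<open>w\<close>.\<close>

definition atoms :: "'w set set \<Rightarrow> 'w set set" where
  "atoms G = range (\<lambda>w. {w'. \<forall>A\<in>G. w' \<in> A \<longleftrightarrow> w \<in> A})"

definition constituents ::
  "('i \<Rightarrow> 'w \<Rightarrow> real) \<Rightarrow> ('i \<Rightarrow> 'w set) \<Rightarrow> 'i set \<Rightarrow> 'w set set" where
  "constituents X K I = {C \<in> atoms (generating_events X K I). C \<subseteq> (\<Union>i\<in>I. K i)}"

text \<open>The \<open>i\<close>-th coordinate of the point attached to the constituent \<open>C\<close>. A constituent is
  contained in \<open>K i\<close> or in \<open>- K i\<close>, and in the former case \<open>X i\<close> is constant on \<open>C\<close>, so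
  \<open>X i ` C\<close> is a singleton.\<close>

definition point_coord ::
  "('i \<Rightarrow> 'w \<Rightarrow> real) \<Rightarrow> ('i \<Rightarrow> 'w set) \<Rightarrow> ('i \<Rightarrow> real) \<Rightarrow> 'w set \<Rightarrow> 'i \<Rightarrow> real" where
  "point_coord X K \<mu> C i = (if C \<subseteq> K i then the_elem (X i ` C) else \<mu> i)"

definition solutions ::
  "('i \<Rightarrow> 'w \<Rightarrow> real) \<Rightarrow> ('i \<Rightarrow> 'w set) \<Rightarrow> ('i \<Rightarrow> real) \<Rightarrow> 'i set \<Rightarrow> ('w set \<Rightarrow> real) set" where
  "solutions X K \<mu> I =
     {\<Lambda>. (\<forall>C \<in> constituents X K I. \<Lambda> C \<ge> 0) \<and>
         (\<Sum>C \<in> constituents X K I. \<Lambda> C) = 1 \<and>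
         (\<forall>i\<in>I. (\<Sum>C \<in> constituents X K I. \<Lambda> C * point_coord X K \<mu> C i) = \<mu> i)}"

text \<open>The set \<open>I\<^sub>0\<close>. It is only used when there are solutions; the supremum is then over a
  nonempty set of numbers in \<open>[0, 1]\<close> and is attained, the coefficients of the solutions forming
  a compact set.\<close>

definition zero_indices ::
  "('i \<Rightarrow> 'w \<Rightarrow> real) \<Rightarrow> ('i \<Rightarrow> 'w set) \<Rightarrow> ('i \<Rightarrow> real) \<Rightarrow> 'i set \<Rightarrow> 'i set" where
  "zero_indices X K \<mu> I =
     {i \<in> I. (SUP \<Lambda> \<in> solutions X K \<mu> I.
                \<Sum>C \<in> {C \<in> constituents X K I. C \<subseteq> K i}. \<Lambda> C) = 0}"

text \<open>The recursion is well-founded, since \<open>zero_indices X K \<mu> I\<close> is a proper subset of the finite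
  set \<open>I\<close> whenever there are solutions; so the least predicate closed under the rule is the only
  one satisfying the defining equivalence, which is \<open>coherent.simps\<close>.\<close>

inductive coherent ::
  "('i \<Rightarrow> 'w \<Rightarrow> real) \<Rightarrow> ('i \<Rightarrow> 'w set) \<Rightarrow> ('i \<Rightarrow> real) \<Rightarrow> 'i set \<Rightarrow> bool"
  for X :: "'i \<Rightarrow> 'w \<Rightarrow> real" and K :: "'i \<Rightarrow> 'w set" and \<mu> :: "'i \<Rightarrow> real" where
  coherentI:
    "\<lbrakk>cond_random_family X K I;
      solutions X K \<mu> I \<noteq> {};
      zero_indices X K \<mu> I \<noteq> {} \<longrightarrow> coherent X K \<mu> (zero_indices X K \<mu> I)\<rbrakk>
     \<Longrightarrow> coherent X K \<mu> I"

text \<open>The conjunction of the conditional events \<open>E i | H i\<close>, \<open>i \<in> S\<close>, where \<open>x S'\<close> is the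
  prevision assessed on the conjunction over \<open>S'\<close>. In the last branch, \<open>S' = {i \<in> S. w \<notin> H i}\<close> is
  the unique nonempty subset of \<open>S\<close> such that \<open>w\<close> lies outside \<open>H i\<close> for \<open>i \<in> S'\<close> and in
  \<open>E i \<inter> H i\<close> for \<open>i \<in> S - S'\<close>.\<close>

definition conjunction ::
  "('i \<Rightarrow> 'w set) \<Rightarrow> ('i \<Rightarrow> 'w set) \<Rightarrow> ('i set \<Rightarrow> real) \<Rightarrow> 'i set \<Rightarrow> 'w \<Rightarrow> real" where
  "conjunction E H x S w =
     (if w \<in> (\<Inter>i\<in>S. E i \<inter> H i) then 1
      else if w \<in> (\<Union>i\<in>S. - E i \<inter> H i) then 0
      else x {i \<in> S. w \<notin> H i})"

definition conditioning_event :: "('i \<Rightarrow> 'w set) \<Rightarrow> 'i set \<Rightarrow> 'w set" where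
  "conditioning_event H S = (\<Union>i\<in>S. H i)"

end

theory Submission imports Defs begin

text \<open>For every \<open>T \<subseteq> {1, 2, 3}\<close> some outcome makes all \<open>H i\<close> true and makes \<open>E i\<close> true exactly for
  \<open>i \<in> T\<close>. Giving it the product weight \<open>(\<Prod>i\<in>T. x {i}) * (\<Prod>i\<notin>T. 1 - x {i})\<close> yields a probability
  under which the \<open>E i\<close> are independent, so that each conjunction has the prescribed expectation.
  All conditioning events have probability one, hence \<open>I\<^sub>0\<close> is empty and the recursion stops at once.
  The product formulas hold outcome by outcome.\<close>

section \<open>Outcomes, atoms, constituents, and a sufficient criterion for coherence\<close>

lemma logically_independentE:
  assumes "logically_independent Fs" and "length bs = length Fs"
  obtains w where "\<And>i. i < length Fs \<Longrightarrow> w \<in> Fs ! i \<longleftrightarrow> bs ! i"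
proof -
  have "(\<Inter>i\<in>{..<length Fs}. if bs ! i then Fs ! i else - (Fs ! i)) \<noteq> {}"
    using assms unfolding logically_independent_def by blast
  then obtain w where w: "w \<in> (\<Inter>i\<in>{..<length Fs}. if bs ! i then Fs ! i else - (Fs ! i))"
    by blast
  have "w \<in> Fs ! i \<longleftrightarrow> bs ! i" if "i < length Fs" for i
    using INT_D[OF w, of i] that by (simp split: if_splits)
  then show thesis
    by (rule that)
qed

text \<open>An atom is determined by the subset of \<open>G\<close> formed by the events that
  contain it, so there are at most as many atoms as subsets of \<open>G\<close>.\<close>

lemma finite_atoms:
  assumes "finite G"
  shows "finite (atoms G)"
proof -
  have "atoms G \<subseteq> (\<lambda>B. {w'. \<forall>A\<in>G. w' \<in> A \<longleftrightarrow> A \<in> B}) ` Pow G"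
  proof
    fix C assume "C \<in> atoms G"
    then obtain w where "C = {w'. \<forall>A\<in>G. w' \<in> A \<longleftrightarrow> w \<in> A}"
      by (auto simp: atoms_def)
    then have "C = (\<lambda>B. {w'. \<forall>A\<in>G. w' \<in> A \<longleftrightarrow> A \<in> B}) {A \<in> G. w \<in> A}"
      by auto
    then show "C \<in> (\<lambda>B. {w'. \<forall>A\<in>G. w' \<in> A \<longleftrightarrow> A \<in> B}) ` Pow G"
      by blast
  qed
  then show ?thesis
    using assms by (meson finite_Pow_iff finite_imageI finite_subset)
qed

lemma finite_constituents:
  assumes "cond_random_family X K I"
  shows "finite (constituents X K I)"
proof -
  have "generating_events X K I
      = K ` I \<union> (\<Union>i\<in>I. (\<lambda>v. {w \<in> K i. X i w = v}) ` X i ` K i)"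
    unfolding generating_events_def by blast
  then have "finite (generating_events X K I)"
    using assms unfolding cond_random_family_def by simp
  then show ?thesis
    by (simp add: constituents_def finite_atoms)
qed

text \<open>Names the function whose range is \<open>atoms G\<close>, so that weight placed on an
  outcome can be moved to the constituent containing it.\<close>

definition atom_of :: "'w set set \<Rightarrow> 'w \<Rightarrow> 'w set" where
  "atom_of G w = {w'. \<forall>A\<in>G. w' \<in> A \<longleftrightarrow> w \<in> A}"

lemma atom_ofD: "\<lbrakk>w' \<in> atom_of G w; A \<in> G; w \<in> A\<rbrakk> \<Longrightarrow> w' \<in> A"
  by (simp add: atom_of_def)

lemma atom_of_subset:
  assumes "i \<in> I" and "w \<in> K i"
  shows "atom_of (generating_events X K I) w \<subseteq> K i"
proof -
  have "K i \<in> generating_events X K I"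
    using assms(1) unfolding generating_events_def by blast
  then show ?thesis
    using assms(2) by (blast dest: atom_ofD)
qed

lemma atom_of_in_constituents:
  assumes "i \<in> I" and "w \<in> K i"
  shows "atom_of (generating_events X K I) w \<in> constituents X K I"
  using atom_of_subset[of i I w K X] assms
  unfolding constituents_def atoms_def atom_of_def by blast

text \<open>The level set of \<open>X i\<close> through \<open>w\<close> inside \<open>K i\<close>
  is itself a generating event, which forces \<open>X i\<close> to be constant on the atom of
  \<open>w\<close>.\<close>

lemma point_coord_atom_of:
  assumes "i \<in> I" and "w \<in> K i"
  shows "point_coord X K \<mu> (atom_of (generating_events X K I) w) i = X i w"
proof -
  let ?C = "atom_of (generating_events X K I) w"
  have "{w' \<in> K i. X i w' = X i w} \<in> generating_events X K I"
    using assms unfolding generating_events_def by blast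
  then have "X i w' = X i w" if "w' \<in> ?C" for w'
    using atom_ofD[OF that] assms(2) by blast
  moreover have "w \<in> ?C"
    by (simp add: atom_of_def)
  ultimately have "X i ` ?C = {X i w}"
    by blast
  then show ?thesis
    using atom_of_subset[of i I w K X] assms by (simp add: point_coord_def)
qed

text \<open>Finitely many weighted outcomes replace the weights on constituents. Their image measure
  is a solution, and it gives every \<open>K i\<close> mass 1 because every outcome lies in every
  \<open>K i\<close>.\<close>

lemma coherent_if_expectation:
  fixes p :: "'t \<Rightarrow> real" and \<omega> :: "'t \<Rightarrow> 'w"
  assumes family: "cond_random_family X K I" and "I \<noteq> {}"
    and "finite T" and nonneg: "\<And>t. t \<in> T \<Longrightarrow> p t \<ge> 0" and total: "sum p T = 1"
    and inside: "\<And>i t. \<lbrakk>i \<in> I; t \<in> T\<rbrakk> \<Longrightarrow> \<omega> t \<in> K i"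
    and expectation: "\<And>i. i \<in> I \<Longrightarrow> (\<Sum>t\<in>T. p t * X i (\<omega> t)) = \<mu> i"
  shows "coherent X K \<mu> I"
proof -
  let ?\<C> = "constituents X K I"
  define c where "c t = atom_of (generating_events X K I) (\<omega> t)" for t
  \<comment> \<open>Distinct indices \<open>t\<close> may fall into the same constituent, so their
    weights are added up.\<close>
  define \<Lambda> where "\<Lambda> C = (\<Sum>t\<in>{t \<in> T. c t = C}. p t)" for C
  have fin: "finite ?\<C>"
    using family by (rule finite_constituents)
  have c_in: "c t \<in> ?\<C>" if "t \<in> T" for t
    using that \<open>I \<noteq> {}\<close> inside unfolding c_def by (auto intro: atom_of_in_constituents)
  \<comment> \<open>Change of variables for the image measure. It is applied to the constant 1, to
    the point coordinates and to the indicator of \<open>C \<subseteq> K i\<close>.\<close>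
  have transfer: "(\<Sum>C\<in>?\<C>. \<Lambda> C * f C) = (\<Sum>t\<in>T. p t * f (c t))" for f
  proof -
    have "(\<Sum>C\<in>?\<C>. \<Lambda> C * f C) = (\<Sum>C\<in>?\<C>. \<Sum>t\<in>{t \<in> T. c t = C}. p t * f (c t))"
      by (simp add: \<Lambda>_def sum_distrib_right)
    also have "\<dots> = (\<Sum>t\<in>T. p t * f (c t))"
      using \<open>finite T\<close> fin c_in by (intro sum.group) auto
    finally show ?thesis .
  qed
  have sum_\<Lambda>: "sum \<Lambda> ?\<C> = 1"
    using transfer[of "\<lambda>_. 1"] total by simp
  have \<Lambda>: "\<Lambda> \<in> solutions X K \<mu> I"
  proof -
    have "\<Lambda> C \<ge> 0" for C
      unfolding \<Lambda>_def by (rule sum_nonneg) (simp add: nonneg)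
    moreover have "(\<Sum>C\<in>?\<C>. \<Lambda> C * point_coord X K \<mu> C i) = \<mu> i" if "i \<in> I" for i
      unfolding transfer expectation[OF that, symmetric]
      using that inside by (intro sum.cong) (simp_all add: c_def point_coord_atom_of)
    ultimately show ?thesis
      using sum_\<Lambda> by (simp add: solutions_def)
  qed
  have "zero_indices X K \<mu> I = {}"
  proof -
    have "(SUP \<Lambda>\<in>solutions X K \<mu> I. \<Sum>C\<in>{C \<in> ?\<C>. C \<subseteq> K i}. \<Lambda> C) \<ge> 1" if "i \<in> I" for i
    proof -
      have "(\<Sum>C\<in>{C \<in> ?\<C>. C \<subseteq> K i}. \<Lambda> C) = (\<Sum>C\<in>?\<C>. \<Lambda> C * (if C \<subseteq> K i then 1 else 0))"
        using fin by (auto simp: sum.inter_filter intro!: sum.cong)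
      also have "\<dots> = (\<Sum>t\<in>T. p t * (if c t \<subseteq> K i then 1 else 0))"
        by (rule transfer)
      also have "\<dots> = sum p T"
        using that inside by (intro sum.cong) (simp_all add: c_def atom_of_subset)
      finally have one: "(\<Sum>C\<in>{C \<in> ?\<C>. C \<subseteq> K i}. \<Lambda> C) = 1"
        using total by simp
      \<comment> \<open>A real supremum dominates its members only when the set is bounded above;
        the total mass 1 of every solution supplies the bound.\<close>
      have "(\<Sum>C\<in>{C \<in> ?\<C>. C \<subseteq> K i}. \<Lambda>' C) \<le> 1" if "\<Lambda>' \<in> solutions X K \<mu> I" for \<Lambda>'
      proof -
        have "(\<Sum>C\<in>{C \<in> ?\<C>. C \<subseteq> K i}. \<Lambda>' C) \<le> sum \<Lambda>' ?\<C>"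
          using that fin by (intro sum_mono2) (auto simp: solutions_def)
        then show ?thesis
          using that by (simp add: solutions_def)
      qed
      then have "bdd_above ((\<lambda>\<Lambda>. \<Sum>C\<in>{C \<in> ?\<C>. C \<subseteq> K i}. \<Lambda> C) ` solutions X K \<mu> I)"
        by (intro bdd_aboveI2)
      from cSUP_upper[OF \<Lambda> this] one show ?thesis
        by simp
    qed
    then show ?thesis
      by (force simp: zero_indices_def)
  qed
  then show ?thesis
    using family \<Lambda> by (intro coherentI) auto
qed

section \<open>Product weights and the product form of conjunctions\<close>

lemma sum_product_weights:
  fixes y :: "'i \<Rightarrow> 'a::comm_ring_1"
  assumes "finite N" and "S \<subseteq> N"
  shows "(\<Sum>T\<in>Pow N. (\<Prod>i\<in>T. y i) * (\<Prod>i\<in>N - T. 1 - y i) * (if S \<subseteq> T then 1 else 0))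
    = (\<Prod>i\<in>S. y i)"
proof -
  \<comment> \<open>With \<open>?g\<close> the factor \<open>y i + ?g i\<close> is
    \<open>y i\<close> on \<open>S\<close> and 1 elsewhere. Expanding the product over
    \<open>N\<close>, the vanishing of \<open>?g\<close> on \<open>S\<close> kills exactly the terms
    with some element of \<open>S\<close> outside \<open>T\<close>.\<close>
  let ?g = "\<lambda>i. if i \<in> S then 0 else 1 - y i"
  have "(\<Prod>i\<in>S. y i) = (\<Prod>i\<in>N. y i + ?g i)"
    using assms by (intro prod.mono_neutral_cong_left) auto
  also have "\<dots> = (\<Sum>T\<in>Pow N. (\<Prod>i\<in>T. y i) * (\<Prod>i\<in>N - T. ?g i))"
    using assms(1) by (rule prod_add)
  also have "\<dots> = (\<Sum>T\<in>Pow N. (\<Prod>i\<in>T. y i) * (\<Prod>i\<in>N - T. 1 - y i) * (if S \<subseteq> T then 1 else 0))"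
  proof (rule sum.cong[OF refl])
    fix T assume "T \<in> Pow N"
    show "(\<Prod>i\<in>T. y i) * (\<Prod>i\<in>N - T. ?g i)
      = (\<Prod>i\<in>T. y i) * (\<Prod>i\<in>N - T. 1 - y i) * (if S \<subseteq> T then 1 else 0)"
    proof (cases "S \<subseteq> T")
      case True
      then have "(\<Prod>i\<in>N - T. ?g i) = (\<Prod>i\<in>N - T. 1 - y i)"
        by (intro prod.cong) auto
      with True show ?thesis
        by simp
    next
      case False
      then have "(\<Prod>i\<in>N - T. ?g i) = 0"
        using assms by (intro prod_zero) auto
      with False show ?thesis
        by simp
    qed
  qed
  finally show ?thesis
    by simp
qed

text \<open>At a fixed outcome, a false conditional event makes both sides 0. Otherwise true ones
  contribute a factor 1 and void ones their previsions, whose product is the assessed value by the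
  hypothesis on \<open>x\<close>.\<close>

lemma conjunction_eq_prod:
  assumes "finite S"
    and x: "\<And>S'. \<lbrakk>S' \<noteq> {}; S' \<subseteq> S\<rbrakk> \<Longrightarrow> x S' = (\<Prod>i\<in>S'. x {i})"
  shows "conjunction E H x S w = (\<Prod>i\<in>S. conjunction E H x {i} w)"
proof -
  have single: "conjunction E H x {i} w = (if w \<notin> H i then x {i} else if w \<in> E i then 1 else 0)" for i
  proof -
    have "{j \<in> {i}. w \<notin> H j} = {i}" if "w \<notin> H i"
      using that by auto
    then show ?thesis
      unfolding conjunction_def by auto
  qed
  consider (all) "\<forall>i\<in>S. w \<in> E i \<inter> H i" | (zero) i where "i \<in> S" "w \<in> - E i \<inter> H i"
    | (void) "\<exists>i\<in>S. w \<notin> E i \<inter> H i" "\<forall>i\<in>S. w \<notin> - E i \<inter> H i"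
    by blast
  then show ?thesis
  proof cases
    case all
    then show ?thesis
      by (simp add: single) (simp add: conjunction_def)
  next
    case zero
    then have "(\<Prod>i\<in>S. conjunction E H x {i} w) = 0"
      using \<open>finite S\<close> by (intro prod_zero) (auto simp: single)
    moreover have "conjunction E H x S w = 0"
      using zero unfolding conjunction_def by auto
    ultimately show ?thesis
      by simp
  next
    case void
    then have "conjunction E H x S w = x {i \<in> S. w \<notin> H i}"
      unfolding conjunction_def by auto
    also have "\<dots> = (\<Prod>i\<in>{i \<in> S. w \<notin> H i}. x {i})"
      using void by (intro x) auto
    also have "\<dots> = (\<Prod>i\<in>S. conjunction E H x {i} w)"
      using \<open>finite S\<close> void by (intro prod.mono_neutral_cong_left) (auto simp: single)
    finally show ?thesis .
  qed
qed

section \<open>Coherence of the family of conjunctions\<close>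

lemma conjunction_family:
  assumes "finite N" and "\<And>i. i \<in> N \<Longrightarrow> H i \<noteq> {}"
  shows "cond_random_family (conjunction E H x) (conditioning_event H) {S. S \<noteq> {} \<and> S \<subseteq> N}"
proof -
  have "finite (conjunction E H x S ` A)" if "S \<subseteq> N" for S A
  proof (rule finite_subset)
    show "conjunction E H x S ` A \<subseteq> {0, 1} \<union> x ` Pow S"
      by (auto simp: conjunction_def)
    show "finite ({0, 1} \<union> x ` Pow S)"
      using assms(1) that by (auto intro: finite_subset)
  qed
  then show ?thesis
    using assms unfolding cond_random_family_def conditioning_event_def by fastforce
qed

lemma coherent_conjunctions:
  fixes E H :: "'i \<Rightarrow> 'w set" and x :: "'i set \<Rightarrow> real"
  assumes "finite N" and "N \<noteq> {}"
    and outcome: "\<And>T. T \<subseteq> N \<Longrightarrow> \<exists>w. \<forall>i\<in>N. w \<in> H i \<and> (w \<in> E i \<longleftrightarrow> i \<in> T)"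
    and unit: "\<And>i. i \<in> N \<Longrightarrow> x {i} \<in> {0..1}"
    and x: "\<And>S. \<lbrakk>S \<noteq> {}; S \<subseteq> N\<rbrakk> \<Longrightarrow> x S = (\<Prod>i\<in>S. x {i})"
  shows "coherent (conjunction E H x) (conditioning_event H) x {S. S \<noteq> {} \<and> S \<subseteq> N}"
proof -
  obtain \<omega> where \<omega>: "\<And>T i. \<lbrakk>T \<subseteq> N; i \<in> N\<rbrakk> \<Longrightarrow> \<omega> T \<in> H i \<and> (\<omega> T \<in> E i \<longleftrightarrow> i \<in> T)"
    using outcome by metis
  define p where "p T = (\<Prod>i\<in>T. x {i}) * (\<Prod>i\<in>N - T. 1 - x {i})" for T
  have weights: "(\<Sum>T\<in>Pow N. p T * (if S \<subseteq> T then 1 else 0)) = (\<Prod>i\<in>S. x {i})" if "S \<subseteq> N" for S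
    unfolding p_def using \<open>finite N\<close> that by (rule sum_product_weights)
  show ?thesis
  proof (rule coherent_if_expectation[where T = "Pow N" and p = p and \<omega> = \<omega>])
    show "cond_random_family (conjunction E H x) (conditioning_event H) {S. S \<noteq> {} \<and> S \<subseteq> N}"
      using \<open>finite N\<close> \<omega>[of "{}"] by (intro conjunction_family) auto
    show "{S. S \<noteq> {} \<and> S \<subseteq> N} \<noteq> {}"
      using \<open>N \<noteq> {}\<close> by blast
    show "finite (Pow N)"
      using \<open>finite N\<close> by simp
    show "p T \<ge> 0" if "T \<in> Pow N" for T
      unfolding p_def using that unit by (intro mult_nonneg_nonneg prod_nonneg) auto
    \<comment> \<open>For \<open>S = {}\<close> the indicator is constantly 1 and the product is
      empty.\<close>
    show "sum p (Pow N) = 1"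
      using weights[of "{}"] by simp
    show "\<omega> T \<in> conditioning_event H S" if "S \<in> {S. S \<noteq> {} \<and> S \<subseteq> N}" "T \<in> Pow N" for S T
      using that \<omega> unfolding conditioning_event_def by blast
    show "(\<Sum>T\<in>Pow N. p T * conjunction E H x S (\<omega> T)) = x S"
      if S: "S \<in> {S. S \<noteq> {} \<and> S \<subseteq> N}" for S
    proof -
      \<comment> \<open>No conditional event is void at \<open>\<omega> T\<close>, so the branch of
        \<open>conjunction\<close> containing \<open>x\<close> is never reached.\<close>
      have "conjunction E H x S (\<omega> T) = (if S \<subseteq> T then 1 else 0)" if "T \<in> Pow N" for T
        using that S \<omega>[of T] unfolding conjunction_def by (auto simp: subset_iff)
      then have "(\<Sum>T\<in>Pow N. p T * conjunction E H x S (\<omega> T)) = (\<Prod>i\<in>S. x {i})"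
        using weights[of S] S by simp
      then show ?thesis
        using x S by simp
    qed
  qed
qed

theorem theorem8:
  fixes E H :: "nat \<Rightarrow> 'w set" and x :: "nat set \<Rightarrow> real"
  assumes "logically_independent [E 1, E 2, E 3, H 1, H 2, H 3]"
    and "H 1 \<noteq> {}" and "H 2 \<noteq> {}" and "H 3 \<noteq> {}"
    and "\<forall>i\<in>{1, 2, 3}. x {i} \<in> {0..1}"
    and "\<forall>i\<in>{1, 2, 3}. \<forall>j\<in>{1, 2, 3}. i \<noteq> j \<longrightarrow> x {i, j} = x {i} * x {j}"
    and "x {1, 2, 3} = x {1} * x {2} * x {3}"
  shows "coherent (conjunction E H x) (conditioning_event H) x {S. S \<noteq> {} \<and> S \<subseteq> {1, 2, 3}}
    \<and> (\<forall>i\<in>{1, 2, 3}. \<forall>j\<in>{1, 2, 3}. i \<noteq> j \<longrightarrow>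
         conjunction E H x {i, j} = (\<lambda>w. conjunction E H x {i} w * conjunction E H x {j} w))
    \<and> conjunction E H x {1, 2, 3} =
        (\<lambda>w. conjunction E H x {1} w * conjunction E H x {2} w * conjunction E H x {3} w)"
proof -
  let ?N = "{1, 2, 3} :: nat set"
  \<comment> \<open>The separate hypotheses on pairs and on the triple are combined into the uniform
    product rule required by the general lemmas; singletons are trivial.\<close>
  have x: "x S = (\<Prod>i\<in>S. x {i})" if "S \<noteq> {}" "S \<subseteq> ?N" for S
  proof -
    have "S \<in> Pow ?N"
      using that by blast
    then consider "S = {1}" | "S = {2}" | "S = {3}" | "S = {1, 2}" | "S = {1, 3}" | "S = {2, 3}"
      | "S = {1, 2, 3}"
      using \<open>S \<noteq> {}\<close> unfolding Pow_insert Pow_empty by auto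
    then show ?thesis
      using assms(6,7) by cases (simp_all add: mult.assoc)
  qed
  have outcome: "\<exists>w. \<forall>i\<in>?N. w \<in> H i \<and> (w \<in> E i \<longleftrightarrow> i \<in> T)" for T
  proof -
    let ?Fs = "[E 1, E 2, E 3, H 1, H 2, H 3]"
    \<comment> \<open>The first three entries encode \<open>T\<close> through the
      \<open>E i\<close>; the last three keep every \<open>H i\<close> true.\<close>
    let ?bs = "[1 \<in> T, 2 \<in> T, 3 \<in> T, True, True, True]"
    obtain w where w: "\<And>i. i < length ?Fs \<Longrightarrow> w \<in> ?Fs ! i \<longleftrightarrow> ?bs ! i"
      by (rule logically_independentE[of ?Fs ?bs]) (use assms(1) in simp, simp, blast)
    show ?thesis
      using w[of 0] w[of 1] w[of 2] w[of 3] w[of 4] w[of 5]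
      by (intro exI[of _ w]) simp
  qed
  have conj: "conjunction E H x S w = (\<Prod>i\<in>S. conjunction E H x {i} w)" if "S \<subseteq> ?N" for S w
    by (rule conjunction_eq_prod) (use that x in \<open>auto intro: finite_subset\<close>)
  show ?thesis
  proof (intro conjI ballI impI)
    show "coherent (conjunction E H x) (conditioning_event H) x {S. S \<noteq> {} \<and> S \<subseteq> ?N}"
    proof (rule coherent_conjunctions)
      show "x {i} \<in> {0..1}" if "i \<in> ?N" for i
        using assms(5) that by blast
    qed (use outcome x in simp_all)
    show "conjunction E H x {i, j} = (\<lambda>w. conjunction E H x {i} w * conjunction E H x {j} w)"
      if "i \<in> ?N" "j \<in> ?N" "i \<noteq> j" for i j
      using conj[of "{i, j}"] that by (intro ext) simp
    show "conjunction E H x ?N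
        = (\<lambda>w. conjunction E H x {1} w * conjunction E H x {2} w * conjunction E H x {3} w)"
      using conj[of ?N] by (intro ext) (simp add: mult.assoc)
  qed
qed

end
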